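(* Let $p$ be a prime, let $F_1\colon\mathbb{F}_p^n\to\mathbb{F}_p^m$ and $F_2\colon\mathbb{F}_p^k\to\mathbb{F}_p^m$ be two almost balanced bent functions, and let $F\colon\mathbb{F}_p^n\times\mathbb{F}_p^k\to\mathbb{F}_p^m$ be defined by $F(x,y)=F_1(x)+F_2(y)$. Then: 1. If $F_1$ and $F_2$ are both of type $(+)$, then $F$ is almost balanced of type $(+)$. 2. If $F_1$ and $F_2$ are both of type $(-)$, then $F$ is almost balanced of type $(+)$. 3. If $F_1$ is of type $(+)$ and $F_2$ is of type $(-)$, then $F$ is almost balanced of type $(-)$.
   Context: A function $F\colon\mathbb{F}_p^n\to\mathbb{F}_p^m$ is bent (perfect nonlinear) if $|\{x: F(x+a)-F(x)=b\}|=p^{n-m}$ for all nonzero $a\in\mathbb{F}_p^n$ and all $b\in\mathbb{F}_p^m$. A bent function $F\colon\mathbb{F}_p^n\to\mathbb{F}_p^m$ is almost balanced of type $(+)$ if for some $\alpha\in\mathbb{F}_p^m$, $|F^{-1}(\alpha)|=p^{n-m}+p^{n/2}-p^{n/2-m}$ and $|F^{-1}(\beta)|=p^{n-m}-p^{n/2-m}$ for all $\beta\neq\alpha$; it is almost balanced of type $(-)$ if for some $\alpha$, $|F^{-1}(\alpha)|=p^{n-m}-p^{n/2}+p^{n/2-m}$ and $|F^{-1}(\beta)|=p^{n-m}+p^{n/2-m}$ for all $\beta\neq\alpha$. It is almost balanced if it is of type $(+)$ or $(-)$. For the function $F$ on $\mathbb{F}_p^n\times\mathbb{F}_p^k\cong\mathbb{F}_p^{n+k}$,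 replace $n$ by $n+k$ in these definitions. *)

theory Defs
  imports "HOL-Analysis.Finite_Cartesian_Product" "HOL-Analysis.Product_Vector"
    "Berlekamp_Zassenhaus.Finite_Field"
begin

text \<open>
  The definitions below are for functions \<open>F\<close> from an \<open>n\<close>-dimensional to an \<open>m\<close>-dimensional
  vector space over the prime field with \<open>p\<close> elements. The numbers \<open>p\<close>, \<open>n\<close>, \<open>m\<close> are explicit
  parameters, so that the definitions apply both to the domain \<open>('p mod_ring)^'n\<close>, of
  dimension \<open>CARD('n)\<close>, and to \<open>(('p mod_ring)^'n) \<times> (('p mod_ring)^'k)\<close>, of dimension
  \<open>CARD('n) + CARD('k)\<close>. The powers of \<open>p\<close> are real powers, since the exponents \<open>n - m\<close>, \<open>n/2\<close>
  and \<open>n/2 - m\<close> need not be natural numbers a priori.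
\<close>

definition bent :: "nat \<Rightarrow> nat \<Rightarrow> nat \<Rightarrow> ('v::{ab_group_add,finite} \<Rightarrow> 'w::{ab_group_add,finite}) \<Rightarrow> bool"
  where "bent p n m F \<longleftrightarrow>
    (\<forall>a b. a \<noteq> 0 \<longrightarrow> real (card {x. F (x + a) - F x = b}) = real p powr (real n - real m))"

definition almost_balanced_plus ::
  "nat \<Rightarrow> nat \<Rightarrow> nat \<Rightarrow> ('v::{ab_group_add,finite} \<Rightarrow> 'w::{ab_group_add,finite}) \<Rightarrow> bool"
  where "almost_balanced_plus p n m F \<longleftrightarrow> bent p n m F \<and>
    (\<exists>\<alpha>. real (card (F -` {\<alpha>})) =
           real p powr (real n - real m) + real p powr (real n / 2) - real p powr (real n / 2 - real m) \<and>
         (\<forall>\<beta>. \<beta> \<noteq> \<alpha> \<longrightarrow> real (card (F -` {\<beta>})) =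
           real p powr (real n - real m) - real p powr (real n / 2 - real m)))"

definition almost_balanced_minus ::
  "nat \<Rightarrow> nat \<Rightarrow> nat \<Rightarrow> ('v::{ab_group_add,finite} \<Rightarrow> 'w::{ab_group_add,finite}) \<Rightarrow> bool"
  where "almost_balanced_minus p n m F \<longleftrightarrow> bent p n m F \<and>
    (\<exists>\<alpha>. real (card (F -` {\<alpha>})) =
           real p powr (real n - real m) - real p powr (real n / 2) + real p powr (real n / 2 - real m) \<and>
         (\<forall>\<beta>. \<beta> \<noteq> \<alpha> \<longrightarrow> real (card (F -` {\<beta>})) =
           real p powr (real n - real m) + real p powr (real n / 2 - real m)))"

definition almost_balanced ::
  "nat \<Rightarrow> nat \<Rightarrow> nat \<Rightarrow> ('v::{ab_group_add,finite} \<Rightarrow> 'w::{ab_group_add,finite}) \<Rightarrow> bool"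
  where "almost_balanced p n m F \<longleftrightarrow> almost_balanced_plus p n m F \<or> almost_balanced_minus p n m F"

end

theory Submission
  imports Defs
begin

text \<open>
  The solutions of \<open>f x + g y = c\<close> are counted one coordinate at a time. When \<open>g\<close> takes a
  constant number \<open>C\<close> of times every value but one, \<open>\<alpha>\<close>, which it takes \<open>C + d\<close> times,
  the count is \<open>C\<close> times the number of \<open>x\<close>, plus \<open>d\<close> times the size of the fibre of \<open>f\<close> over
  \<open>c - \<alpha>\<close>. This gives at once that bentness is inherited (apply it to the derivatives of
  \<open>F\<^sub>1\<close> and \<open>F\<^sub>2\<close>, one of which is balanced) and, encoding the two types by a sign, that
  the sign of \<open>F\<close> is the product of the signs of \<open>F\<^sub>1\<close> and \<open>F\<^sub>2\<close>.
\<close>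

lemma card_add_fibre:
  fixes f :: "'a::finite \<Rightarrow> 'w::ab_group_add" and g :: "'b::finite \<Rightarrow> 'w"
  shows "card {z. f (fst z) + g (snd z) = c} = (\<Sum>x\<in>UNIV. card (g -` {c - f x}))"
proof -
  have "{z. f (fst z) + g (snd z) = c} = (SIGMA x:UNIV. g -` {c - f x})"
    by (auto simp: algebra_simps)
  then show ?thesis by simp
qed

text \<open>The two-valued count below puts the regular function in the second summand; this
  symmetry covers the case where it is the first.\<close>

lemma card_add_fibre_commute:
  fixes f :: "'a::finite \<Rightarrow> 'w::ab_group_add" and g :: "'b::finite \<Rightarrow> 'w"
  shows "card {z. f (fst z) + g (snd z) = c} = card {z. g (fst z) + f (snd z) = c}"
  by (rule bij_betw_same_card[of prod.swap], rule bij_betw_byWitness[of _ prod.swap])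
     (auto simp: add.commute)

lemma card_add_fibre_two_valued:
  fixes f :: "'a::finite \<Rightarrow> 'w::ab_group_add" and g :: "'b::finite \<Rightarrow> 'w"
  assumes "\<And>\<beta>. real (card (g -` {\<beta>})) = C + (if \<beta> = \<alpha> then d else 0)"
  shows "real (card {z. f (fst z) + g (snd z) = c}) =
    real CARD('a) * C + d * real (card (f -` {c - \<alpha>}))"
proof -
  \<comment> \<open>The surplus \<open>d\<close> is collected exactly by those \<open>x\<close>
    whose partner value \<open>c - f x\<close> is the exceptional one.\<close>
  have "(\<Sum>x\<in>UNIV. if c - f x = \<alpha> then d else 0) = (\<Sum>x\<in>f -` {c - \<alpha>}. d)"
    by (rule sum.mono_neutral_cong_right) (auto simp: algebra_simps)
  then show ?thesis
    by (simp add: card_add_fibre assms sum.distrib mult.commute)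
qed

lemma bent_add:
  fixes F1 :: "'a::{ab_group_add,finite} \<Rightarrow> 'w::{ab_group_add,finite}"
    and F2 :: "'b::{ab_group_add,finite} \<Rightarrow> 'w"
  assumes p: "p > 0" and cards: "CARD('a) = p ^ n" "CARD('b) = p ^ k"
    and bent: "bent p n m F1" "bent p k m F2"
    and F: "\<And>x y. F (x, y) = F1 x + F2 y"
  shows "bent p (n + k) m F"
  unfolding bent_def
proof (intro allI impI)
  fix a :: "'a \<times> 'b" and c :: 'w
  assume "a \<noteq> 0"
  obtain u v where a: "a = (u, v)" by (cases a)
  define f where "f = (\<lambda>x. F1 (x + u) - F1 x)"
  define g where "g = (\<lambda>y. F2 (y + v) - F2 y)"
  \<comment> \<open>The derivative of \<open>F\<close> in direction \<open>(u, v)\<close> splits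
    into derivatives of \<open>F1\<close> and \<open>F2\<close>. If \<open>u\<close> or
    \<open>v\<close> is zero, that derivative vanishes identically, so only the one with nonzero
    direction is known to be balanced.\<close>
  have eq: "{z. F (z + a) - F z = c} = {z. f (fst z) + g (snd z) = c}"
    by (auto simp: a F f_def g_def algebra_simps)
  have powers: "real (p ^ n) = real p powr real n" "real (p ^ k) = real p powr real k"
    using p by (simp_all add: powr_realpow)
  consider "u \<noteq> 0" | "v \<noteq> 0" using \<open>a \<noteq> 0\<close> a by (auto simp: zero_prod_def)
  then show "real (card {z. F (z + a) - F z = c}) = real p powr (real (n + k) - real m)"
  proof cases
    case 1
    \<comment> \<open>A balanced function is the two-valued case with surplus \<open>d = 0\<close>;
      the exceptional value 0 is an arbitrary choice.\<close>
    then have "real (card (f -` {\<beta>})) = real p powr (real n - real m) + (if \<beta> = 0 then 0 else 0)"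
      for \<beta>
      using bent(1) by (simp add: bent_def f_def vimage_def)
    from card_add_fibre_two_valued[OF this, of g c] show ?thesis
      unfolding eq card_add_fibre_commute[of f g] cards(2) powers
      by (simp add: algebra_simps flip: powr_add)
  next
    case 2
    then have "real (card (g -` {\<beta>})) = real p powr (real k - real m) + (if \<beta> = 0 then 0 else 0)"
      for \<beta>
      using bent(2) by (simp add: bent_def g_def vimage_def)
    from card_add_fibre_two_valued[OF this, of f c] show ?thesis
      unfolding eq cards(1) powers
      by (simp add: algebra_simps flip: powr_add)
  qed
qed

text \<open>Types (+) and (-) are \<open>s = 1\<close> and \<open>s = -1\<close>. The fibre sizes
  are written as a constant plus a surplus at \<alpha>, the shape required by
  \<open>card_add_fibre_two_valued\<close>.\<close>

definition almost_balanced_sign ::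
  "real \<Rightarrow> nat \<Rightarrow> nat \<Rightarrow> nat \<Rightarrow> ('v::{ab_group_add,finite} \<Rightarrow> 'w::{ab_group_add,finite}) \<Rightarrow> bool"
  where "almost_balanced_sign s p n m F \<longleftrightarrow> bent p n m F \<and>
    (\<exists>\<alpha>. \<forall>\<beta>. real (card (F -` {\<beta>})) =
      (real p powr (real n - real m) - s * real p powr (real n / 2 - real m)) +
      (if \<beta> = \<alpha> then s * real p powr (real n / 2) else 0))"

lemma almost_balanced_plus_iff_sign:
  "almost_balanced_plus p n m F \<longleftrightarrow> almost_balanced_sign 1 p n m F"
  unfolding almost_balanced_plus_def almost_balanced_sign_def
  by (intro conj_cong refl ex_cong1) (auto simp: algebra_simps)

lemma almost_balanced_minus_iff_sign:
  "almost_balanced_minus p n m F \<longleftrightarrow> almost_balanced_sign (-1) p n m F"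
  unfolding almost_balanced_minus_def almost_balanced_sign_def
  by (intro conj_cong refl ex_cong1) (auto simp: algebra_simps)

lemma almost_balanced_sign_add:
  fixes F1 :: "'a::{ab_group_add,finite} \<Rightarrow> 'w::{ab_group_add,finite}"
    and F2 :: "'b::{ab_group_add,finite} \<Rightarrow> 'w"
  assumes p: "p > 0" and cards: "CARD('a) = p ^ n" "CARD('b) = p ^ k"
    and F1: "almost_balanced_sign s p n m F1" and F2: "almost_balanced_sign t p k m F2"
    and F: "\<And>x y. F (x, y) = F1 x + F2 y"
  shows "almost_balanced_sign (s * t) p (n + k) m F"
proof -
  obtain \<alpha> where \<alpha>: "\<And>\<beta>. real (card (F1 -` {\<beta>})) =
      (real p powr (real n - real m) - s * real p powr (real n / 2 - real m)) +
      (if \<beta> = \<alpha> then s * real p powr (real n / 2) else 0)"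
    using F1 unfolding almost_balanced_sign_def by blast
  obtain \<alpha>' where \<alpha>': "\<And>\<beta>. real (card (F2 -` {\<beta>})) =
      (real p powr (real k - real m) - t * real p powr (real k / 2 - real m)) +
      (if \<beta> = \<alpha>' then t * real p powr (real k / 2) else 0)"
    using F2 unfolding almost_balanced_sign_def by blast
  have "real (card (F -` {\<gamma>})) =
      (real p powr (real (n + k) - real m) - s * t * real p powr (real (n + k) / 2 - real m)) +
      (if \<gamma> = \<alpha> + \<alpha>' then s * t * real p powr (real (n + k) / 2) else 0)" for \<gamma>
  proof -
    \<comment> \<open>In terms of \<open>P\<close>, \<open>Q\<close>, \<open>M\<close> the claim is
      a polynomial identity: in \<open>P*P*(Q*Q*M - t*Q*M) + t*Q*(P*P*M - s*P*M)\<close> the terms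
      \<open>t*P*P*Q*M\<close> cancel.\<close>
    define P where "P = real p powr (real n / 2)"
    define Q where "Q = real p powr (real k / 2)"
    define M where "M = real p powr (- real m)"
    have pn: "real (p ^ n) = P * P"
      using p by (simp add: P_def powr_realpow flip: powr_add)
    have PP: "real p powr (real n - real m) = P * P * M"
      "real p powr (real n / 2 - real m) = P * M"
      by (simp_all add: P_def M_def flip: powr_add)
    have QQ: "real p powr (real k - real m) = Q * Q * M"
      "real p powr (real k / 2 - real m) = Q * M"
      by (simp_all add: Q_def M_def flip: powr_add)
    have PQ: "real p powr (real (n + k) - real m) = P * P * (Q * Q) * M"
      "real p powr (real (n + k) / 2 - real m) = P * Q * M"
      "real p powr (real (n + k) / 2) = P * Q"
      by (simp_all add: P_def Q_def M_def add_divide_distrib flip: powr_add)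
    have fibre: "F -` {\<gamma>} = {z. F1 (fst z) + F2 (snd z) = \<gamma>}"
      by (auto simp: F)
    \<comment> \<open>The count involves the fibre of \<open>F1\<close> over
      \<open>\<gamma> - \<alpha>'\<close>, so the exceptional value of \<open>F\<close> is the sum
      of the two given ones.\<close>
    have "\<gamma> - \<alpha>' = \<alpha> \<longleftrightarrow> \<gamma> = \<alpha> + \<alpha>'"
      by (simp add: diff_eq_eq)
    then show ?thesis
      unfolding fibre card_add_fibre_two_valued[OF \<alpha>', of F1 \<gamma>, folded Q_def] cards(1)
        \<alpha>[folded P_def] pn PP QQ PQ
      by (simp add: algebra_simps)
  qed
  moreover have "bent p (n + k) m F"
    using F1 F2 F by (intro bent_add[OF p cards, where ?F1.0 = F1 and ?F2.0 = F2])
      (simp_all add: almost_balanced_sign_def)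
  ultimately show ?thesis
    unfolding almost_balanced_sign_def by blast
qed

theorem proposition3p10:
  fixes F1 :: "('p::prime_card mod_ring)^'n \<Rightarrow> ('p mod_ring)^'m"
    and F2 :: "('p mod_ring)^'k \<Rightarrow> ('p mod_ring)^'m"
    and F :: "(('p mod_ring)^'n) \<times> (('p mod_ring)^'k) \<Rightarrow> ('p mod_ring)^'m"
  assumes "almost_balanced CARD('p) CARD('n) CARD('m) F1"
    and "almost_balanced CARD('p) CARD('k) CARD('m) F2"
    and "\<And>x y. F (x, y) = F1 x + F2 y"
  shows "(almost_balanced_plus CARD('p) CARD('n) CARD('m) F1 \<and>
          almost_balanced_plus CARD('p) CARD('k) CARD('m) F2 \<longrightarrow>
          almost_balanced_plus CARD('p) (CARD('n) + CARD('k)) CARD('m) F)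
       \<and> (almost_balanced_minus CARD('p) CARD('n) CARD('m) F1 \<and>
          almost_balanced_minus CARD('p) CARD('k) CARD('m) F2 \<longrightarrow>
          almost_balanced_plus CARD('p) (CARD('n) + CARD('k)) CARD('m) F)
       \<and> (almost_balanced_plus CARD('p) CARD('n) CARD('m) F1 \<and>
          almost_balanced_minus CARD('p) CARD('k) CARD('m) F2 \<longrightarrow>
          almost_balanced_minus CARD('p) (CARD('n) + CARD('k)) CARD('m) F)"
proof -
  have cards: "CARD(('p mod_ring)^'n) = CARD('p) ^ CARD('n)"
    "CARD(('p mod_ring)^'k) = CARD('p) ^ CARD('k)"
    by (simp_all)
  have "almost_balanced_sign (s * t) CARD('p) (CARD('n) + CARD('k)) CARD('m) F"
    if "almost_balanced_sign s CARD('p) CARD('n) CARD('m) F1"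
      "almost_balanced_sign t CARD('p) CARD('k) CARD('m) F2" for s t
    by (rule almost_balanced_sign_add[OF _ cards that assms(3)]) simp
  \<comment> \<open>The sign products 1, 1 and -1 give the three claims in order.\<close>
  from this[of 1 1] this[of "-1" "-1"] this[of 1 "-1"] show ?thesis
    by (simp add: almost_balanced_plus_iff_sign almost_balanced_minus_iff_sign)
qed

end
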